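(* Let $\mathscr{H}$ be a complex Hilbert space and let $B,C\in\mathbb{B}(\mathscr{H})$. Then $$\sqrt{\frac14 w(B^2+C^2)+ \frac14 \left(w^2(B)+w^2(C) \right)+ \frac12 \left| w^2(B)-w^2(C)\right|}\ \leq\ w_{e}(B,C).$$
   Context: $\mathbb{B}(\mathscr{H})$ denotes the bounded linear operators on $\mathscr{H}$. The numerical radius is $w(T)=\sup\{|\langle Tx,x\rangle| : x\in\mathscr{H},\ \|x\|=1\}$, and $w^2(\cdot)$ means $(w(\cdot))^2$. The Euclidean operator radius of $B,C$ is $w_e(B,C)=\sup\left\{\sqrt{|\langle Bx,x\rangle|^2+|\langle Cx,x\rangle|^2} : x\in\mathscr{H},\ \|x\|=1\right\}$. *)

theory Defs
  imports "HOL-Analysis.Analysis"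
begin

class complex_vector = real_vector +
  fixes scaleC :: "complex \<Rightarrow> 'a \<Rightarrow> 'a"  (infixr \<open>*\<^sub>C\<close> 75)
  assumes scaleC_add_right: "c *\<^sub>C (x + y) = c *\<^sub>C x + c *\<^sub>C y"
    and scaleC_add_left: "(c + d) *\<^sub>C x = c *\<^sub>C x + d *\<^sub>C x"
    and scaleC_scaleC: "c *\<^sub>C (d *\<^sub>C x) = (c * d) *\<^sub>C x"
    and scaleC_one: "1 *\<^sub>C x = x"
    and scaleR_scaleC: "scaleR r x = complex_of_real r *\<^sub>C x"

text \<open>The inner product is linear in its first argument. By \<open>cinner_commute\<close>, \<open>cinner x x\<close> is real.\<close>

class complex_inner = complex_vector + real_normed_vector +
  fixes cinner :: "'a \<Rightarrow> 'a \<Rightarrow> complex"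
  assumes cinner_commute: "cinner x y = cnj (cinner y x)"
    and cinner_add_left: "cinner (x + y) z = cinner x z + cinner y z"
    and cinner_scaleC_left: "cinner (c *\<^sub>C x) y = c * cinner x y"
    and cinner_ge_zero: "0 \<le> Re (cinner x x)"
    and cinner_eq_zero_iff: "cinner x x = 0 \<longleftrightarrow> x = 0"
    and norm_eq_sqrt_cinner: "norm x = sqrt (Re (cinner x x))"

class complex_hilbert_space = complex_inner + complete_space

instantiation complex :: complex_hilbert_space
begin

definition scaleC_complex :: "complex \<Rightarrow> complex \<Rightarrow> complex"
  where "scaleC_complex c z = c * z"

definition cinner_complex :: "complex \<Rightarrow> complex \<Rightarrow> complex"
  where "cinner_complex z w = z * cnj w"

instance
proof
  fix z :: complex
  show "norm z = sqrt (Re (cinner z z))"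
    by (simp add: cinner_complex_def cmod_def power2_eq_square)
qed (auto simp: scaleC_complex_def cinner_complex_def algebra_simps scaleR_conv_of_real)

end

definition bounded_clinear :: "('a::complex_inner \<Rightarrow> 'b::complex_inner) \<Rightarrow> bool"
  where "bounded_clinear T \<longleftrightarrow> bounded_linear T \<and> (\<forall>c x. T (c *\<^sub>C x) = c *\<^sub>C T x)"

text \<open>
  Both suprema run over nonnegative reals, so inserting \<open>0\<close> changes them only on the zero space.
  That space has no unit vectors, and \<open>Sup {}\<close> is an unspecified real; the insertion
  gives the supremum the usual value \<open>0\<close> there.
\<close>

definition numerical_radius :: "('a::complex_inner \<Rightarrow> 'a) \<Rightarrow> real"
  where "numerical_radius T = Sup (insert 0 {cmod (cinner (T x) x) | x. norm x = 1})"

definition euclidean_operator_radius ::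
    "('a::complex_inner \<Rightarrow> 'a) \<Rightarrow> ('a \<Rightarrow> 'a) \<Rightarrow> real"
  where "euclidean_operator_radius B C =
    Sup (insert 0 {sqrt ((cmod (cinner (B x) x))\<^sup>2 + (cmod (cinner (C x) x))\<^sup>2) | x. norm x = 1})"

end

(* Proof idea: the numerical radius is subadditive and satisfies the power inequality
   w(T^2) \<le> w(T)^2, so w(B^2 + C^2) \<le> w(B)^2 + w(C)^2. Hence the quantity under the root is at most
   max (w(B)^2) (w(C)^2), which is at most w_e(B, C)^2. *)

theory Submission
  imports Defs
begin

section \<open>Inner products\<close>

lemma cinner_add_right: "cinner x (y + z) = cinner x y + cinner x z"
  for x :: "'a::complex_inner"
  by (metis cinner_add_left cinner_commute complex_cnj_add)

lemma cinner_scaleC_right: "cinner x (c *\<^sub>C y) = cnj c * cinner x y"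
  for x :: "'a::complex_inner"
  by (metis cinner_scaleC_left cinner_commute complex_cnj_mult)

lemma cinner_scaleR_left: "cinner (r *\<^sub>R x) y = of_real r * cinner x y"
  for x :: "'a::complex_inner"
  by (simp add: scaleR_scaleC cinner_scaleC_left)

lemma cinner_scaleR_right: "cinner x (r *\<^sub>R y) = of_real r * cinner x y"
  for x :: "'a::complex_inner"
  by (simp add: scaleR_scaleC cinner_scaleC_right)

lemma cinner_minus_left: "cinner (- x) y = - cinner x y"
  for x :: "'a::complex_inner"
  using cinner_scaleR_left[of "-1" x y] by simp

lemma cinner_minus_right: "cinner x (- y) = - cinner x y"
  for x :: "'a::complex_inner"
  using cinner_scaleR_right[of x "-1" y] by simp

lemma cinner_diff_left: "cinner (x - y) z = cinner x z - cinner y z"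
  for x :: "'a::complex_inner"
  using cinner_add_left[of x "- y" z] by (simp add: cinner_minus_left)

lemma cinner_diff_right: "cinner x (y - z) = cinner x y - cinner x z"
  for x :: "'a::complex_inner"
  using cinner_add_right[of x y "- z"] by (simp add: cinner_minus_right)

lemmas cinner_simps =
  cinner_add_left cinner_add_right cinner_diff_left cinner_diff_right
  cinner_scaleR_left cinner_scaleR_right cinner_scaleC_left cinner_scaleC_right

lemma Re_cinner_self: "Re (cinner x x) = (norm x)\<^sup>2"
  for x :: "'a::complex_inner"
  by (simp add: norm_eq_sqrt_cinner cinner_ge_zero)

text \<open>The class axioms give homogeneity of the norm for real scalars only; for complex scalars
  it comes from the inner product.\<close>

lemma norm_scaleC: "norm (c *\<^sub>C x) = cmod c * norm x"
  for x :: "'a::complex_inner"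
proof -
  have "cinner (c *\<^sub>C x) (c *\<^sub>C x) = of_real ((cmod c)\<^sup>2) * cinner x x"
    by (simp only: cinner_simps complex_norm_square mult.assoc mult.left_commute)
  then have "(norm (c *\<^sub>C x))\<^sup>2 = (cmod c * norm x)\<^sup>2"
    by (simp add: Re_cinner_self[symmetric] power_mult_distrib)
  then show ?thesis
    by (simp add: power2_eq_iff_nonneg)
qed

text \<open>Squaring the triangle inequality, which the normed space already provides, leaves
  exactly this bound on the cross term.\<close>

lemma Re_cinner_le: "Re (cinner x y) \<le> norm x * norm y"
  for x :: "'a::complex_inner"
proof -
  have "Re (cinner y x) = Re (cinner x y)"
    using arg_cong[OF cinner_commute[of y x], of Re] by simp
  then have "(norm (x + y))\<^sup>2 = (norm x)\<^sup>2 + (norm y)\<^sup>2 + 2 * Re (cinner x y)"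
    by (simp add: Re_cinner_self[symmetric] cinner_simps)
  moreover have "(norm (x + y))\<^sup>2 \<le> (norm x + norm y)\<^sup>2"
    by (intro power_mono norm_triangle_ineq norm_ge_zero)
  ultimately show ?thesis
    by (simp add: power2_sum)
qed

text \<open>Half of the negated argument of \<open>c\<close> serves as the argument of
  \<open>z\<close>. The phase is wanted as a square because passing from an operator T to z T
  multiplies T^2 by z^2.\<close>

lemma exists_square_phase: "\<exists>z. cmod z = 1 \<and> z\<^sup>2 * c = of_real (cmod c)"
proof -
  define z where "z = cis (- Arg c / 2)"
  have "z\<^sup>2 = rcis 1 (- Arg c)"
    by (simp add: z_def power2_eq_square cis_mult rcis_def)
  then have "z\<^sup>2 * c = rcis 1 (- Arg c) * rcis (cmod c) (Arg c)"
    by (simp only: rcis_cmod_Arg)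
  also have "\<dots> = of_real (cmod c)"
    by (simp add: rcis_mult)
  finally show ?thesis
    by (intro exI[of _ z]) (simp add: z_def)
qed

text \<open>Cauchy-Schwarz: rotating \<open>x\<close> by a phase makes the inner product real and
  nonnegative, so the bound on real parts suffices.\<close>

lemma cmod_cinner_le: "cmod (cinner x y) \<le> norm x * norm y"
  for x :: "'a::complex_inner"
proof -
  obtain z where z: "cmod z = 1" "z\<^sup>2 * cinner x y = of_real (cmod (cinner x y))"
    using exists_square_phase by blast
  have "cmod (cinner x y) = Re (cinner (z\<^sup>2 *\<^sub>C x) y)"
    by (simp add: cinner_scaleC_left z)
  also have "\<dots> \<le> norm (z\<^sup>2 *\<^sub>C x) * norm y"
    by (rule Re_cinner_le)
  finally show ?thesis
    by (simp add: norm_scaleC norm_power z)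
qed

section \<open>The numerical radius\<close>

text \<open>Ensures that the supremum defining \<open>numerical_radius\<close> is taken over a set
  bounded above, without which \<open>Sup\<close> yields no upper bound.\<close>

lemma bounded_clinear_quadratic_form_bound:
  assumes "bounded_clinear T"
  obtains K where "\<And>x. norm x = 1 \<Longrightarrow> cmod (cinner (T x) x) \<le> K"
proof -
  obtain K where "\<And>x. norm (T x) \<le> norm x * K"
    using assms bounded_linear.bounded unfolding bounded_clinear_def by metis
  then have "cmod (cinner (T x) x) \<le> K" if "norm x = 1" for x
    using order_trans[OF cmod_cinner_le, of "T x" x K] that by (metis mult_1 mult.right_neutral)
  then show ?thesis
    using that by blast
qed

lemma cmod_cinner_le_numerical_radius:
  assumes "bounded_clinear T" "norm x = 1"
  shows "cmod (cinner (T x) x) \<le> numerical_radius T"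
proof -
  obtain K where "\<And>x. norm x = 1 \<Longrightarrow> cmod (cinner (T x) x) \<le> K"
    using bounded_clinear_quadratic_form_bound[OF assms(1)] by blast
  then have "bdd_above (insert 0 {cmod (cinner (T x) x) | x. norm x = 1})"
    unfolding bdd_above_insert by (auto intro!: bdd_aboveI[of _ K])
  then show ?thesis
    unfolding numerical_radius_def using assms(2) by (intro cSup_upper) auto
qed

lemma numerical_radius_nonneg:
  assumes "bounded_clinear T"
  shows "0 \<le> numerical_radius T"
proof (cases "\<exists>x::'a. norm x = 1")
  case True
  then show ?thesis
    using cmod_cinner_le_numerical_radius[OF assms] norm_ge_zero order_trans by blast
next
  case False
  then show ?thesis
    by (simp add: numerical_radius_def)
qed

lemma numerical_radius_le:
  assumes "0 \<le> r" "\<And>x. norm x = 1 \<Longrightarrow> cmod (cinner (T x) x) \<le> r"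
  shows "numerical_radius T \<le> r"
  unfolding numerical_radius_def using assms by (intro cSup_least) auto

text \<open>The homogeneous form, obtained by normalizing \<open>x\<close>; the power inequality
  evaluates the quadratic form at vectors that are not unit vectors.\<close>

lemma cmod_cinner_le_numerical_radius_norm:
  assumes "bounded_clinear T"
  shows "cmod (cinner (T x) x) \<le> numerical_radius T * (norm x)\<^sup>2"
proof (cases "x = 0")
  case True
  then show ?thesis
    using cmod_cinner_le[of "T x" x] by simp
next
  case False
  define u where "u = x /\<^sub>R norm x"
  have "norm u = 1" and x: "x = norm x *\<^sub>R u"
    using False by (auto simp: u_def)
  have "T x = norm x *\<^sub>R T u"
    using assms x by (metis bounded_clinear_def linear_cmul bounded_linear.linear)
  then have "cinner (T x) x = cinner (norm x *\<^sub>R T u) (norm x *\<^sub>R u)"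
    using x by simp
  then have "cmod (cinner (T x) x) = (norm x)\<^sup>2 * cmod (cinner (T u) u)"
    by (simp add: cinner_simps norm_mult power2_eq_square)
  then show ?thesis
    using mult_left_mono[OF cmod_cinner_le_numerical_radius[OF assms \<open>norm u = 1\<close>], of "(norm x)\<^sup>2"]
    by (simp add: mult.commute)
qed

text \<open>
  With \<open>u = r x + T x\<close> and \<open>v = r x - T x\<close>, the factorization
  \<open>r\<^sup>2 - T\<^sup>2 = (r - T)(r + T) = (r + T)(r - T)\<close> and \<open>u + v = 2 r x\<close> give
  \<open>\<langle>(r - T) u, u\<rangle> + \<langle>(r + T) v, v\<rangle> = 2 r \<langle>(r\<^sup>2 - T\<^sup>2) x, x\<rangle>\<close>.
\<close>

lemma Re_cinner_square_le:
  fixes T :: "'a::complex_inner \<Rightarrow> 'a"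
  assumes "linear T" "0 < r" and bound: "\<And>y. cmod (cinner (T y) y) \<le> r * (norm y)\<^sup>2"
  shows "Re (cinner (T (T x)) x) \<le> r\<^sup>2 * (norm x)\<^sup>2"
proof -
  define u v where "u = r *\<^sub>R x + T x" and "v = r *\<^sub>R x - T x"
  \<comment> \<open>The bound on the form of T makes the forms of r - T and r + T have nonnegative
    real part.\<close>
  have pos: "0 \<le> r * Re (cinner y y) - Re (cinner (T y) y)"
    "0 \<le> r * Re (cinner y y) + Re (cinner (T y) y)" for y
    using bound[of y] abs_Re_le_cmod[of "cinner (T y) y"] unfolding Re_cinner_self by linarith+
  have Tu: "T u = r *\<^sub>R T x + T (T x)" and Tv: "T v = r *\<^sub>R T x - T (T x)"
    using assms(1) by (simp_all add: u_def v_def linear_add linear_diff linear_cmul)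
  have "(r * Re (cinner u u) - Re (cinner (T u) u)) + (r * Re (cinner v v) + Re (cinner (T v) v))
      = 2 * r * (r\<^sup>2 * Re (cinner x x) - Re (cinner (T (T x)) x))"
    unfolding Tu Tv by (simp add: u_def v_def cinner_simps algebra_simps power2_eq_square)
  then have "0 \<le> 2 * r * (r\<^sup>2 * Re (cinner x x) - Re (cinner (T (T x)) x))"
    using pos(1)[of u] pos(2)[of v] by linarith
  then have "0 \<le> r\<^sup>2 * Re (cinner x x) - Re (cinner (T (T x)) x)"
    using \<open>0 < r\<close> by (simp add: zero_le_mult_iff)
  then show ?thesis
    by (simp add: Re_cinner_self)
qed

text \<open>The power inequality for squares. A phase z is chosen so that S = z T satisfies
  \<langle>S^2 x, x\<rangle> = |\<langle>T^2 x, x\<rangle>|, while the moduli of the forms of S and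
  T agree; the bound on real parts then applies to S.\<close>

lemma cmod_cinner_square_le:
  fixes T :: "'a::complex_inner \<Rightarrow> 'a"
  assumes T: "bounded_clinear T" and x: "norm x = 1"
  shows "cmod (cinner (T (T x)) x) \<le> (numerical_radius T)\<^sup>2"
proof -
  obtain z where z: "cmod z = 1"
      "z\<^sup>2 * cinner (T (T x)) x = of_real (cmod (cinner (T (T x)) x))"
    using exists_square_phase by blast
  define S where "S y = z *\<^sub>C T y" for y
  have lin: "linear T" and scale: "T (c *\<^sub>C y) = c *\<^sub>C T y" for c y
    using T by (auto simp: bounded_clinear_def bounded_linear.linear)
  have "linear S"
    using lin
    by (intro linearI)
      (simp_all add: S_def linear_add scale scaleC_add_right scaleR_scaleC scaleC_scaleC mult.commute)
  have square: "Re (cinner (S (S x)) x) = cmod (cinner (T (T x)) x)"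
    using z by (simp add: S_def scale scaleC_scaleC cinner_scaleC_left power2_eq_square)
  have bound: "cmod (cinner (S y) y) \<le> numerical_radius T * (norm y)\<^sup>2" for y
    using cmod_cinner_le_numerical_radius_norm[OF T, of y] z
    by (simp add: S_def cinner_scaleC_left norm_mult)
  \<comment> \<open>\<open>Re_cinner_square_le\<close> divides by r, but the numerical radius may be
    0. Hence every r above it is used, and r decreases to it at the end.\<close>
  have le: "cmod (cinner (T (T x)) x) \<le> r\<^sup>2" if "numerical_radius T < r" for r
  proof -
    have "cmod (cinner (S y) y) \<le> r * (norm y)\<^sup>2" for y
      using bound that by (meson less_imp_le mult_right_mono order_trans zero_le_power2)
    then show ?thesis
      using Re_cinner_square_le[OF \<open>linear S\<close>, of r x] that numerical_radius_nonneg[OF T] x square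
      by simp
  qed
  have "sqrt (cmod (cinner (T (T x)) x)) \<le> r" if "numerical_radius T < r" for r
    using le[OF that] that numerical_radius_nonneg[OF T] by (intro real_le_lsqrt) auto
  then have "sqrt (cmod (cinner (T (T x)) x)) \<le> numerical_radius T"
    by (rule dense_ge)
  then show ?thesis
    by (rule sqrt_le_D)
qed

text \<open>At each unit vector the triangle inequality splits the form, and the power inequality
  bounds each summand.\<close>

lemma numerical_radius_sum_squares_le:
  fixes B C :: "'a::complex_inner \<Rightarrow> 'a"
  assumes "bounded_clinear B" "bounded_clinear C"
  shows "numerical_radius (\<lambda>x. (B ^^ 2) x + (C ^^ 2) x)
    \<le> (numerical_radius B)\<^sup>2 + (numerical_radius C)\<^sup>2"
proof (rule numerical_radius_le)
  fix x :: 'a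
  assume "norm x = 1"
  then show "cmod (cinner ((B ^^ 2) x + (C ^^ 2) x) x)
      \<le> (numerical_radius B)\<^sup>2 + (numerical_radius C)\<^sup>2"
    using cmod_cinner_square_le[OF assms(1), of x] cmod_cinner_square_le[OF assms(2), of x]
    by (simp add: numeral_2_eq_2 cinner_add_left norm_triangle_mono)
qed simp

section \<open>The Euclidean operator radius\<close>

lemma numerical_radius_le_euclidean_operator_radius:
  fixes B C :: "'a::complex_inner \<Rightarrow> 'a"
  assumes "bounded_clinear B" "bounded_clinear C"
  shows "numerical_radius B \<le> euclidean_operator_radius B C"
    and "numerical_radius C \<le> euclidean_operator_radius B C"
proof -
  let ?f = "\<lambda>x. sqrt ((cmod (cinner (B x) x))\<^sup>2 + (cmod (cinner (C x) x))\<^sup>2)"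
  let ?E = "insert 0 {?f x | x. norm x = 1}"
  \<comment> \<open>The Euclidean norm of a pair is at most the sum of its entries, so the supremum
    is over a bounded set.\<close>
  have "?f x \<le> numerical_radius B + numerical_radius C" if "norm x = 1" for x
    using sqrt_sum_squares_le_sum[of "cmod (cinner (B x) x)" "cmod (cinner (C x) x)"]
      cmod_cinner_le_numerical_radius[OF assms(1) that]
      cmod_cinner_le_numerical_radius[OF assms(2) that] by simp
  then have bdd: "bdd_above ?E"
    unfolding bdd_above_insert
    by (auto intro!: bdd_aboveI[of _ "numerical_radius B + numerical_radius C"])
  have f: "?f x \<le> euclidean_operator_radius B C" if "norm x = 1" for x
    unfolding euclidean_operator_radius_def using that bdd by (intro cSup_upper) auto
  \<comment> \<open>The inserted 0 gives this even on the zero space, where there is no unit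
    vector.\<close>
  have nonneg: "0 \<le> euclidean_operator_radius B C"
    unfolding euclidean_operator_radius_def using bdd by (intro cSup_upper) auto
  show "numerical_radius B \<le> euclidean_operator_radius B C"
    using order_trans[OF real_sqrt_sum_squares_ge1 f] by (intro numerical_radius_le nonneg)
  show "numerical_radius C \<le> euclidean_operator_radius B C"
    using order_trans[OF real_sqrt_sum_squares_ge2 f] by (intro numerical_radius_le nonneg)
qed

theorem theorem2p2:
  fixes B C :: "'a::complex_hilbert_space \<Rightarrow> 'a"
  assumes "bounded_clinear B" and "bounded_clinear C"
  shows "sqrt (1/4 * numerical_radius (\<lambda>x. (B ^^ 2) x + (C ^^ 2) x)
             + 1/4 * ((numerical_radius B)\<^sup>2 + (numerical_radius C)\<^sup>2)
             + 1/2 * \<bar>(numerical_radius B)\<^sup>2 - (numerical_radius C)\<^sup>2\<bar>)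
         \<le> euclidean_operator_radius B C"
proof (rule real_le_lsqrt)
  note le = numerical_radius_le_euclidean_operator_radius[OF assms]
  show "0 \<le> euclidean_operator_radius B C"
    using numerical_radius_nonneg[OF assms(1)] le(1) by linarith
  have "(numerical_radius B)\<^sup>2 \<le> (euclidean_operator_radius B C)\<^sup>2"
    "(numerical_radius C)\<^sup>2 \<le> (euclidean_operator_radius B C)\<^sup>2"
    using le assms by (auto intro!: power_mono numerical_radius_nonneg)
  then show "1/4 * numerical_radius (\<lambda>x. (B ^^ 2) x + (C ^^ 2) x)
             + 1/4 * ((numerical_radius B)\<^sup>2 + (numerical_radius C)\<^sup>2)
             + 1/2 * \<bar>(numerical_radius B)\<^sup>2 - (numerical_radius C)\<^sup>2\<bar>
         \<le> (euclidean_operator_radius B C)\<^sup>2"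
    \<comment> \<open>With b and c the squared radii, the left side is at most (b + c)/4 + (b + c)/4
      + |b - c|/2 = max b c.\<close>
    using numerical_radius_sum_squares_le[OF assms] by argo
qed

end
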